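(* Let $\varphi^{\mathcal{T}}(\overline{x},\overline{y})$ be a realizable $\mathrm{LTL}^{\mathcal{T}}$ specification, $\varphi^{\mathbb{B}}$ its Boolean abstraction, $\alpha$ a partitioner, $\Gamma$ an adaptive provider description with extra variables $\overline{z}$, and $\beta_\Gamma$ an adaptive provider. Let $\rho^{\mathbb{B}}$ be a winning strategy for $\varphi^{\mathbb{B}}$ and $\rho^{\mathcal{T}}_\Gamma$ the combined adaptive strategy of $\alpha$, $\rho^{\mathbb{B}}$ and $\beta_\Gamma$. Then $\rho^{\mathcal{T}}_\Gamma$ is winning for $\varphi^{\mathcal{T}}$, i.e. for every sequence of environment inputs $(v_{x,i},v_{z,i})_{i\ge0}$, the trace of valuations $(v_{x,i},v_{y,i})_{i\ge0}$ it produces satisfies $\varphi^{\mathcal{T}}$.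
   Context: Let $\mathcal{T}$ be a first-order theory with domain $\mathbb{D}$. An $\mathrm{LTL}^{\mathcal{T}}$ formula is an LTL formula whose atoms are $\mathcal{T}$-literals $l_1,\dots,l_n$, with variables split into disjoint environment variables $\overline{x}$ and system variables $\overline{y}$; $\mathrm{val}(\overline{x})$ is the set of maps $\overline{x}\to\mathbb{D}$ (similarly for other variable sets). A literal holds at a trace position iff the valuation there makes it true; other operators have standard LTL semantics. A system strategy is $\langle Q,q_0,\delta,o\rangle$ with $Q$ finite, $\delta:Q\times I\to Q$, $o:Q\times I\to O$ (for input set $I$, output set $O$); on inputs $i_0i_1\dots$ it outputs $o(q_k,i_k)$ with $q_{k+1}=\delta(q_k,i_k)$; it is winning if all resulting traces satisfy the specification; a specification is realizable if a winning strategy exists. Same notions for propositional LTL with Boolean environment propositions $\overline{e}$ and system propositions $\overline{s}$. Boolean abstraction: fresh system propositions $\overline{s}=\{s_1,\dots,s_n\}$; a choice is $c\subseteq\overline{s}$ (identified with a valuation of $\overline{s}$) with $f_c(\overline{x},\overline{y})=\bigwedge_{s_i\in c}l_i\wedge\bigwedge_{s_i\notin c}\neg l_i$; a reaction $r$ is a set of choices with $f_r(\overline{x})=\bigwedge_{c\in r}\exists\overline{y}.f_c\wedge\bigwedge_{c\notin r}\forall\overline{y}.\neg f_c$, valid if $\exists\overline{x}.f_r$ holds; each valid $r$ gets a fresh environment proposition $e_r$; $\varphi^{\mathbb{B}}=\varphi^{\mathcal{T}}[l_i\leftarrow s_i]\wedge\square(\varphi^{legal}\to\varphi^{extra})$ with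 $\varphi^{legal}$ saying exactly one $e_r$ is true and $\varphi^{extra}=\bigwedge_r(e_r\to\bigvee_{c\in r}(\bigwedge_{s_i\in c}s_i\wedge\bigwedge_{s_i\notin c}\neg s_i))$. A partitioner is a function $\alpha:\mathrm{val}(\overline{x})\to\overline{e}$ with $\alpha(v_x)=e_r$ whenever $r$ is valid and $f_r(v_x)$ is true (identified with the valuation of $\overline{e}$ making only $\alpha(v_x)$ true). Let $\overline{z}$ be a set of variables disjoint from $\overline{x},\overline{y}$. An adaptive provider description is a family $\Gamma=\{\psi^+_{(r,c)}\}$ containing, for each valid reaction $r$ and choice $c\in r$, a formula $\psi^+_{(r,c)}(\overline{x},\overline{z},\overline{y})$ (free variables among $\overline{x},\overline{z},\overline{y}$) such that $\forall\overline{x},\overline{z}.\exists\overline{y}.[(f_r(\overline{x})\to f_c(\overline{x},\overline{y}))\wedge\psi^+_{(r,c)}]$ is valid. An adaptive provider is a function $\beta_\Gamma:\mathrm{val}(\overline{x})\times\mathrm{val}(\overline{z})\times\mathrm{val}(\overline{s})\to\mathrm{val}(\overline{y})$ such that for every $v_x$, $v_z$, valid reaction $r$ with $f_r(v_x)$ true and choice $c\in r$, $f_c(\overline{x}\leftarrow v_x,\overline{y}\leftarrow\beta_\Gamma(v_x,v_z,c))$ is true. For $\rho^{\mathbb{B}}=\langle Q,q_0,\delta,o\rangle$, the combined adaptive strategy $\rho^{\mathcal{T}}_\Gamma=\langle Q,q_0,\delta',o'\rangle$ takes inputs $(v_x,v_z)\in\mathrm{val}(\overline{x})\times\mathrm{val}(\overline{z})$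 (both chosen by the environment) and is defined by $\delta'(q,(v_x,v_z))=\delta(q,\alpha(v_x))$ and $o'(q,(v_x,v_z))=\beta_\Gamma(v_x,v_z,o(q,\alpha(v_x)))$. *)

theory Defs
  imports Main
begin

section \<open>First-order literals and formulas over a fixed interpretation\<close>

text \<open>
  Symbols are applied to argument lists and carry no arity; a ranked signature is the special
  case in which each symbol is only used with one list length.
\<close>

datatype ('f, 'v) trm = Var 'v | Fun 'f "('f, 'v) trm list"

datatype ('f, 'p, 'v) atm = Eq "('f, 'v) trm" "('f, 'v) trm" | Pred 'p "('f, 'v) trm list"

datatype ('f, 'p, 'v) lit = Pos "('f, 'p, 'v) atm" | Neg "('f, 'p, 'v) atm"

datatype ('f, 'p, 'v) fm =
    FTrue
  | FAtm "('f, 'p, 'v) atm"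
  | FNot "('f, 'p, 'v) fm"
  | FAnd "('f, 'p, 'v) fm" "('f, 'p, 'v) fm"
  | FEx 'v "('f, 'p, 'v) fm"

abbreviation FImp :: "('f, 'p, 'v) fm \<Rightarrow> ('f, 'p, 'v) fm \<Rightarrow> ('f, 'p, 'v) fm" where
  "FImp A B \<equiv> FNot (FAnd A (FNot B))"

abbreviation FAll :: "'v \<Rightarrow> ('f, 'p, 'v) fm \<Rightarrow> ('f, 'p, 'v) fm" where
  "FAll v A \<equiv> FNot (FEx v (FNot A))"

definition FConj :: "('f, 'p, 'v) fm list \<Rightarrow> ('f, 'p, 'v) fm" where
  "FConj As = foldr FAnd As FTrue"

definition FExs :: "'v list \<Rightarrow> ('f, 'p, 'v) fm \<Rightarrow> ('f, 'p, 'v) fm" where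
  "FExs vs A = foldr FEx vs A"

definition FAlls :: "'v list \<Rightarrow> ('f, 'p, 'v) fm \<Rightarrow> ('f, 'p, 'v) fm" where
  "FAlls vs A = foldr FAll vs A"

primrec fm_of_lit :: "('f, 'p, 'v) lit \<Rightarrow> ('f, 'p, 'v) fm" where
  "fm_of_lit (Pos a) = FAtm a"
| "fm_of_lit (Neg a) = FNot (FAtm a)"

primrec vars_trm :: "('f, 'v) trm \<Rightarrow> 'v set" where
  "vars_trm (Var v) = {v}"
| "vars_trm (Fun f ts) = \<Union> (set (map vars_trm ts))"

primrec vars_atm :: "('f, 'p, 'v) atm \<Rightarrow> 'v set" where
  "vars_atm (Eq s t) = vars_trm s \<union> vars_trm t"
| "vars_atm (Pred p ts) = \<Union> (vars_trm ` set ts)"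

primrec vars_lit :: "('f, 'p, 'v) lit \<Rightarrow> 'v set" where
  "vars_lit (Pos a) = vars_atm a"
| "vars_lit (Neg a) = vars_atm a"

primrec fv :: "('f, 'p, 'v) fm \<Rightarrow> 'v set" where
  "fv FTrue = {}"
| "fv (FAtm a) = vars_atm a"
| "fv (FNot A) = fv A"
| "fv (FAnd A B) = fv A \<union> fv B"
| "fv (FEx v A) = fv A - {v}"

text \<open>
  The theory is given by its intended interpretation; the domain is the type \<open>'d\<close>, and a formula
  holds (or is valid) when it is true in this interpretation.
\<close>

record ('f, 'p, 'd) interp =
  fun_of :: "'f \<Rightarrow> 'd list \<Rightarrow> 'd"
  pred_of :: "'p \<Rightarrow> 'd list \<Rightarrow> bool"

text \<open>
  A valuation of \<open>V\<close> is a map with domain \<open>V\<close>, and \<open>++\<close> joins valuations of disjoint sets.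
  The value of a variable outside the domain is unspecified; it never matters for formulas whose
  free variables lie in the domain.
\<close>

definition valuations :: "'v set \<Rightarrow> ('v \<rightharpoonup> 'd) set" where
  "valuations V = {m. dom m = V}"

primrec eval :: "('f, 'p, 'd) interp \<Rightarrow> ('v \<rightharpoonup> 'd) \<Rightarrow> ('f, 'v) trm \<Rightarrow> 'd" where
  "eval M m (Var v) = the (m v)"
| "eval M m (Fun f ts) = fun_of M f (map (eval M m) ts)"

primrec sat_atm :: "('f, 'p, 'd) interp \<Rightarrow> ('v \<rightharpoonup> 'd) \<Rightarrow> ('f, 'p, 'v) atm \<Rightarrow> bool" where
  "sat_atm M m (Eq s t) \<longleftrightarrow> eval M m s = eval M m t"
| "sat_atm M m (Pred p ts) \<longleftrightarrow> pred_of M p (map (eval M m) ts)"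

primrec sat_lit :: "('f, 'p, 'd) interp \<Rightarrow> ('v \<rightharpoonup> 'd) \<Rightarrow> ('f, 'p, 'v) lit \<Rightarrow> bool" where
  "sat_lit M m (Pos a) \<longleftrightarrow> sat_atm M m a"
| "sat_lit M m (Neg a) \<longleftrightarrow> \<not> sat_atm M m a"

primrec sat :: "('f, 'p, 'd) interp \<Rightarrow> ('v \<rightharpoonup> 'd) \<Rightarrow> ('f, 'p, 'v) fm \<Rightarrow> bool" where
  "sat M m FTrue \<longleftrightarrow> True"
| "sat M m (FAtm a) \<longleftrightarrow> sat_atm M m a"
| "sat M m (FNot A) \<longleftrightarrow> \<not> sat M m A"
| "sat M m (FAnd A B) \<longleftrightarrow> sat M m A \<and> sat M m B"
| "sat M m (FEx v A) \<longleftrightarrow> (\<exists>d. sat M (m(v \<mapsto> d)) A)"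

section \<open>Linear temporal logic\<close>

datatype 'a ltl =
    LTrue
  | LAtom 'a
  | LNot "'a ltl"
  | LAnd "'a ltl" "'a ltl"
  | LNext "'a ltl"
  | LUntil "'a ltl" "'a ltl"

abbreviation LOr :: "'a ltl \<Rightarrow> 'a ltl \<Rightarrow> 'a ltl" where
  "LOr \<phi> \<psi> \<equiv> LNot (LAnd (LNot \<phi>) (LNot \<psi>))"

abbreviation LImp :: "'a ltl \<Rightarrow> 'a ltl \<Rightarrow> 'a ltl" where
  "LImp \<phi> \<psi> \<equiv> LNot (LAnd \<phi> (LNot \<psi>))"

abbreviation LFinally :: "'a ltl \<Rightarrow> 'a ltl" where
  "LFinally \<phi> \<equiv> LUntil LTrue \<phi>"

abbreviation LGlobally :: "'a ltl \<Rightarrow> 'a ltl" where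
  "LGlobally \<phi> \<equiv> LNot (LFinally (LNot \<phi>))"

definition LConj :: "'a ltl list \<Rightarrow> 'a ltl" where
  "LConj \<phi>s = foldr LAnd \<phi>s LTrue"

definition LDisj :: "'a ltl list \<Rightarrow> 'a ltl" where
  "LDisj \<phi>s = foldr (\<lambda>\<phi> \<psi>. LOr \<phi> \<psi>) \<phi>s (LNot LTrue)"

primrec ltl_sat :: "('s \<Rightarrow> 'a \<Rightarrow> bool) \<Rightarrow> (nat \<Rightarrow> 's) \<Rightarrow> nat \<Rightarrow> 'a ltl \<Rightarrow> bool" where
  "ltl_sat holds \<sigma> i LTrue \<longleftrightarrow> True"
| "ltl_sat holds \<sigma> i (LAtom a) \<longleftrightarrow> holds (\<sigma> i) a"
| "ltl_sat holds \<sigma> i (LNot \<phi>) \<longleftrightarrow> \<not> ltl_sat holds \<sigma> i \<phi>"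
| "ltl_sat holds \<sigma> i (LAnd \<phi> \<psi>) \<longleftrightarrow> ltl_sat holds \<sigma> i \<phi> \<and> ltl_sat holds \<sigma> i \<psi>"
| "ltl_sat holds \<sigma> i (LNext \<phi>) \<longleftrightarrow> ltl_sat holds \<sigma> (Suc i) \<phi>"
| "ltl_sat holds \<sigma> i (LUntil \<phi> \<psi>) \<longleftrightarrow>
     (\<exists>j\<ge>i. ltl_sat holds \<sigma> j \<psi> \<and> (\<forall>k. i \<le> k \<and> k < j \<longrightarrow> ltl_sat holds \<sigma> k \<phi>))"

section \<open>Strategies\<close>

record ('q, 'i, 'o) strategy =
  states :: "'q set"
  init :: 'q
  trans :: "'q \<Rightarrow> 'i \<Rightarrow> 'q"
  out :: "'q \<Rightarrow> 'i \<Rightarrow> 'o"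

definition is_strategy :: "'i set \<Rightarrow> 'o set \<Rightarrow> ('q, 'i, 'o) strategy \<Rightarrow> bool" where
  "is_strategy Inp Out \<rho> \<longleftrightarrow>
     finite (states \<rho>) \<and> init \<rho> \<in> states \<rho> \<and>
     (\<forall>q\<in>states \<rho>. \<forall>i\<in>Inp. trans \<rho> q i \<in> states \<rho> \<and> out \<rho> q i \<in> Out)"

primrec state_at :: "('q, 'i, 'o) strategy \<Rightarrow> (nat \<Rightarrow> 'i) \<Rightarrow> nat \<Rightarrow> 'q" where
  "state_at \<rho> \<iota> 0 = init \<rho>"
| "state_at \<rho> \<iota> (Suc k) = trans \<rho> (state_at \<rho> \<iota> k) (\<iota> k)"

definition output_at :: "('q, 'i, 'o) strategy \<Rightarrow> (nat \<Rightarrow> 'i) \<Rightarrow> nat \<Rightarrow> 'o" where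
  "output_at \<rho> \<iota> k = out \<rho> (state_at \<rho> \<iota> k) (\<iota> k)"

definition winning ::
  "'i set \<Rightarrow> 'o set \<Rightarrow> ((nat \<Rightarrow> 'i \<times> 'o) \<Rightarrow> bool) \<Rightarrow> ('q, 'i, 'o) strategy \<Rightarrow> bool" where
  "winning Inp Out spec \<rho> \<longleftrightarrow>
     is_strategy Inp Out \<rho> \<and>
     (\<forall>\<iota>. (\<forall>k. \<iota> k \<in> Inp) \<longrightarrow> spec (\<lambda>k. (\<iota> k, output_at \<rho> \<iota> k)))"

section \<open>Specifications modulo theories\<close>

text \<open>
  The literals of a specification are listed without repetition as \<open>ls\<close>; the variable tuples are
  the lists \<open>xs\<close> (environment) and \<open>ys\<close> (system).
\<close>

definition ltl_spec ::
  "'v list \<Rightarrow> 'v list \<Rightarrow> ('f, 'p, 'v) lit list \<Rightarrow> ('f, 'p, 'v) lit ltl \<Rightarrow> bool" where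
  "ltl_spec xs ys ls \<phi> \<longleftrightarrow>
     distinct xs \<and> distinct ys \<and> set xs \<inter> set ys = {} \<and>
     distinct ls \<and> set ls = set_ltl \<phi> \<and>
     (\<forall>l\<in>set ls. vars_lit l \<subseteq> set xs \<union> set ys)"

definition models_T ::
  "('f, 'p, 'd) interp \<Rightarrow> ('f, 'p, 'v) lit ltl \<Rightarrow> (nat \<Rightarrow> ('v \<rightharpoonup> 'd) \<times> ('v \<rightharpoonup> 'd)) \<Rightarrow> bool" where
  "models_T M \<phi> \<sigma> \<longleftrightarrow> ltl_sat (\<lambda>(vx, vy). sat_lit M (vx ++ vy)) \<sigma> 0 \<phi>"

text \<open>State spaces are finite, so taking them among the natural numbers is no restriction.\<close>

definition realizable_T ::
  "('f, 'p, 'd) interp \<Rightarrow> 'v list \<Rightarrow> 'v list \<Rightarrow> ('f, 'p, 'v) lit ltl \<Rightarrow> bool" where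
  "realizable_T M xs ys \<phi> \<longleftrightarrow>
     (\<exists>\<rho> :: (nat, 'v \<rightharpoonup> 'd, 'v \<rightharpoonup> 'd) strategy.
        winning (valuations (set xs)) (valuations (set ys)) (models_T M \<phi>) \<rho>)"

section \<open>Boolean abstraction\<close>

text \<open>
  \<open>S i\<close> stands for the literal \<open>ls ! i\<close> (indices start at 0). Every set of choices has a
  proposition \<open>E r\<close>, but only those of valid reactions are environment propositions.
\<close>

datatype sprop = S nat

type_synonym choice = "sprop set"
type_synonym reaction = "choice set"

datatype eprop = E reaction

definition sprops :: "('f, 'p, 'v) lit list \<Rightarrow> sprop list" where
  "sprops ls = map S [0..<length ls]"

definition choices :: "('f, 'p, 'v) lit list \<Rightarrow> choice list" where
  "choices ls = map set (subseqs (sprops ls))"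

definition reactions :: "('f, 'p, 'v) lit list \<Rightarrow> reaction list" where
  "reactions ls = map set (subseqs (choices ls))"

definition f_choice :: "('f, 'p, 'v) lit list \<Rightarrow> choice \<Rightarrow> ('f, 'p, 'v) fm" where
  "f_choice ls c = FConj
     (map (\<lambda>i. if S i \<in> c then fm_of_lit (ls ! i) else FNot (fm_of_lit (ls ! i))) [0..<length ls])"

definition f_reaction ::
  "'v list \<Rightarrow> ('f, 'p, 'v) lit list \<Rightarrow> reaction \<Rightarrow> ('f, 'p, 'v) fm" where
  "f_reaction ys ls r = FConj
     (map (\<lambda>c. if c \<in> r then FExs ys (f_choice ls c) else FAlls ys (FNot (f_choice ls c)))
        (choices ls))"

definition valid_reactions ::
  "('f, 'p, 'd) interp \<Rightarrow> 'v list \<Rightarrow> 'v list \<Rightarrow> ('f, 'p, 'v) lit list \<Rightarrow> reaction list" where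
  "valid_reactions M xs ys ls =
     filter (\<lambda>r. sat M Map.empty (FExs xs (f_reaction ys ls r))) (reactions ls)"

definition eprops ::
  "('f, 'p, 'd) interp \<Rightarrow> 'v list \<Rightarrow> 'v list \<Rightarrow> ('f, 'p, 'v) lit list \<Rightarrow> eprop set" where
  "eprops M xs ys ls = E ` set (valid_reactions M xs ys ls)"

definition abs_lit :: "('f, 'p, 'v) lit list \<Rightarrow> ('f, 'p, 'v) lit \<Rightarrow> sprop" where
  "abs_lit ls l = S (THE i. i < length ls \<and> ls ! i = l)"

definition phi_legal ::
  "('f, 'p, 'd) interp \<Rightarrow> 'v list \<Rightarrow> 'v list \<Rightarrow> ('f, 'p, 'v) lit list \<Rightarrow> (eprop + sprop) ltl" where
  "phi_legal M xs ys ls =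
     (let R = valid_reactions M xs ys ls in
      LDisj (map (\<lambda>r. LAnd (LAtom (Inl (E r)))
        (LConj (map (\<lambda>r'. LNot (LAtom (Inl (E r')))) (filter (\<lambda>r'. r' \<noteq> r) R)))) R))"

definition choice_ltl :: "('f, 'p, 'v) lit list \<Rightarrow> choice \<Rightarrow> (eprop + sprop) ltl" where
  "choice_ltl ls c = LConj
     (map (\<lambda>s. if s \<in> c then LAtom (Inr s) else LNot (LAtom (Inr s))) (sprops ls))"

definition phi_extra ::
  "('f, 'p, 'd) interp \<Rightarrow> 'v list \<Rightarrow> 'v list \<Rightarrow> ('f, 'p, 'v) lit list \<Rightarrow> (eprop + sprop) ltl" where
  "phi_extra M xs ys ls = LConj
     (map (\<lambda>r. LImp (LAtom (Inl (E r)))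
        (LDisj (map (choice_ltl ls) (filter (\<lambda>c. c \<in> r) (choices ls)))))
      (valid_reactions M xs ys ls))"

definition boolean_abstraction ::
  "('f, 'p, 'd) interp \<Rightarrow> 'v list \<Rightarrow> 'v list \<Rightarrow> ('f, 'p, 'v) lit list \<Rightarrow>
   ('f, 'p, 'v) lit ltl \<Rightarrow> (eprop + sprop) ltl" where
  "boolean_abstraction M xs ys ls \<phi> =
     LAnd (map_ltl (\<lambda>l. Inr (abs_lit ls l)) \<phi>)
       (LGlobally (LImp (phi_legal M xs ys ls) (phi_extra M xs ys ls)))"

text \<open>A Boolean valuation is represented by the set of its true propositions.\<close>

fun holds_B :: "eprop set \<times> sprop set \<Rightarrow> eprop + sprop \<Rightarrow> bool" where
  "holds_B (es, ss) (Inl e) \<longleftrightarrow> e \<in> es"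
| "holds_B (es, ss) (Inr s) \<longleftrightarrow> s \<in> ss"

definition models_B ::
  "(eprop + sprop) ltl \<Rightarrow> (nat \<Rightarrow> eprop set \<times> sprop set) \<Rightarrow> bool" where
  "models_B \<phi> \<sigma> \<longleftrightarrow> ltl_sat holds_B \<sigma> 0 \<phi>"

section \<open>Partitioners, adaptive providers and their combination\<close>

definition partitioner ::
  "('f, 'p, 'd) interp \<Rightarrow> 'v list \<Rightarrow> 'v list \<Rightarrow> ('f, 'p, 'v) lit list \<Rightarrow>
   (('v \<rightharpoonup> 'd) \<Rightarrow> eprop) \<Rightarrow> bool" where
  "partitioner M xs ys ls \<alpha> \<longleftrightarrow>
     (\<forall>vx\<in>valuations (set xs). \<alpha> vx \<in> eprops M xs ys ls \<and>
        (\<forall>r\<in>set (valid_reactions M xs ys ls). sat M vx (f_reaction ys ls r) \<longrightarrow> \<alpha> vx = E r))"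

definition adaptive_provider_description ::
  "('f, 'p, 'd) interp \<Rightarrow> 'v list \<Rightarrow> 'v list \<Rightarrow> 'v list \<Rightarrow> ('f, 'p, 'v) lit list \<Rightarrow>
   (reaction \<Rightarrow> choice \<Rightarrow> ('f, 'p, 'v) fm) \<Rightarrow> bool" where
  "adaptive_provider_description M xs zs ys ls \<Gamma> \<longleftrightarrow>
     (\<forall>r\<in>set (valid_reactions M xs ys ls). \<forall>c\<in>r.
        fv (\<Gamma> r c) \<subseteq> set xs \<union> set zs \<union> set ys \<and>
        sat M Map.empty (FAlls xs (FAlls zs (FExs ys
          (FAnd (FImp (f_reaction ys ls r) (f_choice ls c)) (\<Gamma> r c))))))"

text \<open>
  Only the choice formula is required of an adaptive provider; that its values also satisfy the
  formulas of the description is not part of the definition.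
\<close>

definition adaptive_provider ::
  "('f, 'p, 'd) interp \<Rightarrow> 'v list \<Rightarrow> 'v list \<Rightarrow> 'v list \<Rightarrow> ('f, 'p, 'v) lit list \<Rightarrow>
   (('v \<rightharpoonup> 'd) \<Rightarrow> ('v \<rightharpoonup> 'd) \<Rightarrow> choice \<Rightarrow> ('v \<rightharpoonup> 'd)) \<Rightarrow> bool" where
  "adaptive_provider M xs zs ys ls \<beta> \<longleftrightarrow>
     (\<forall>vx\<in>valuations (set xs). \<forall>vz\<in>valuations (set zs).
        (\<forall>c\<in>Pow (set (sprops ls)). \<beta> vx vz c \<in> valuations (set ys)) \<and>
        (\<forall>r\<in>set (valid_reactions M xs ys ls). sat M vx (f_reaction ys ls r) \<longrightarrow>
           (\<forall>c\<in>r. sat M (vx ++ \<beta> vx vz c) (f_choice ls c))))"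

definition combined_adaptive_strategy ::
  "(('v \<rightharpoonup> 'd) \<Rightarrow> eprop) \<Rightarrow> ('q, eprop set, choice) strategy \<Rightarrow>
   (('v \<rightharpoonup> 'd) \<Rightarrow> ('v \<rightharpoonup> 'd) \<Rightarrow> choice \<Rightarrow> ('v \<rightharpoonup> 'd)) \<Rightarrow>
   ('q, ('v \<rightharpoonup> 'd) \<times> ('v \<rightharpoonup> 'd), 'v \<rightharpoonup> 'd) strategy" where
  "combined_adaptive_strategy \<alpha> \<rho> \<beta> =
     \<lparr>states = states \<rho>, init = init \<rho>,
      trans = (\<lambda>q (vx, vz). trans \<rho> q {\<alpha> vx}),
      out = (\<lambda>q (vx, vz). \<beta> vx vz (out \<rho> q {\<alpha> vx}))\<rparr>"

end

theory Submission
  imports Defs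
begin

text \<open>
  Every environment valuation satisfies exactly the reaction formula of the set of choices it
  leaves open, so the partitioner always feeds a single legal reaction proposition to \<open>\<rho>\<close>. The
  extra requirement then forces \<open>\<rho>\<close> to answer with a choice of that reaction, and the provider
  realizes this choice by a system valuation that makes exactly the literals in the choice true.
  The theory trace and the Boolean trace therefore agree on all literals at every position.
\<close>

lemma sat_FConj: "sat M m (FConj As) \<longleftrightarrow> (\<forall>A\<in>set As. sat M m A)"
  by (induction As) (auto simp: FConj_def)

lemma sat_FAlls_FNot: "sat M m (FAlls vs (FNot A)) \<longleftrightarrow> \<not> sat M m (FExs vs A)"
  by (induction vs arbitrary: m) (auto simp: FAlls_def FExs_def)

text \<open>The map \<open>m'\<close> supplies the witnesses for the whole quantifier block at once.
  Its domain is exactly \<open>set vs\<close>, so overriding \<open>m\<close> by it changes only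
  quantified variables.\<close>

lemma sat_FExsI:
  assumes "sat M (m ++ m') A" and "dom m' = set vs"
  shows "sat M m (FExs vs A)"
  using assms
proof (induction vs arbitrary: m m')
  case Nil
  then show ?case by (simp add: FExs_def)
next
  case (Cons v vs)
  obtain d where "m' v = Some d"
    using Cons.prems(2) by auto
  moreover have "m' x = None" if "x \<noteq> v" "x \<notin> set vs" for x
    using that Cons.prems(2) by (auto simp: dom_def)
  \<comment> \<open>At \<open>v\<close> both sides give \<open>d\<close>: if \<open>v\<close> recurs
    in \<open>vs\<close>, the restricted map still sends it to \<open>d\<close>, and otherwise the
    update does.\<close>
  ultimately have "m ++ m' = m(v \<mapsto> d) ++ (m' |` set vs)"
    by (auto simp: fun_eq_iff map_add_def restrict_map_def split: option.splits)
  then have "sat M (m(v \<mapsto> d)) (FExs vs A)"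
    using Cons.prems by (intro Cons.IH[of _ "m' |` set vs"]) (auto simp del: fun_upd_apply)
  then show ?case by (auto simp: FExs_def)
qed

lemma sat_fm_of_lit: "sat M m (fm_of_lit l) \<longleftrightarrow> sat_lit M m l"
  by (cases l) auto

text \<open>Literals outside the choice are negated, so a choice formula fixes the truth value of
  every literal. The equivalence is what lets literals under negations or in \<open>LUntil\<close>
  be transferred later.\<close>

lemma sat_f_choice:
  "sat M m (f_choice ls c) \<longleftrightarrow> (\<forall>i<length ls. S i \<in> c \<longleftrightarrow> sat_lit M m (ls ! i))"
  by (simp add: f_choice_def sat_FConj sat_fm_of_lit if_distrib[of "sat M m"] if_bool_eq_conj
      del: if_image_distrib) auto

lemma set_choices: "set (choices ls) = Pow (set (sprops ls))"
  by (simp add: choices_def subseqs_powset)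

lemma set_reactions: "set (reactions ls) = Pow (set (choices ls))"
  by (simp add: reactions_def subseqs_powset)

lemma ex_valid_reaction:
  assumes "vx \<in> valuations (set xs)"
  shows "\<exists>r\<in>set (valid_reactions M xs ys ls). sat M vx (f_reaction ys ls r)"
proof -
  define r where "r = {c \<in> set (choices ls). sat M vx (FExs ys (f_choice ls c))}"
  have sat_r: "sat M vx (f_reaction ys ls r)"
    by (auto simp: f_reaction_def sat_FConj sat_FAlls_FNot r_def)
  \<comment> \<open>Validity of the reaction is witnessed by \<open>vx\<close> itself, since
    \<open>Map.empty ++ vx\<close> is \<open>vx\<close>.\<close>
  then have "sat M Map.empty (FExs xs (f_reaction ys ls r))"
    using assms by (intro sat_FExsI[where m' = vx]) (auto simp: valuations_def)
  then have "r \<in> set (valid_reactions M xs ys ls)"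
    by (auto simp: valid_reactions_def set_reactions r_def)
  with sat_r show ?thesis by blast
qed

lemma ltl_sat_LConj: "ltl_sat h \<sigma> i (LConj \<phi>s) \<longleftrightarrow> (\<forall>\<phi>\<in>set \<phi>s. ltl_sat h \<sigma> i \<phi>)"
  by (induction \<phi>s) (auto simp: LConj_def)

lemma ltl_sat_LDisj: "ltl_sat h \<sigma> i (LDisj \<phi>s) \<longleftrightarrow> (\<exists>\<phi>\<in>set \<phi>s. ltl_sat h \<sigma> i \<phi>)"
  by (induction \<phi>s) (auto simp: LDisj_def)

text \<open>The semantics sees a trace only through the truth of atoms at each position. Agreement
  is asked only for atoms of \<phi>, because \<open>abs_lit\<close> is meaningful only for listed
  literals.\<close>

lemma ltl_sat_map_ltl:
  assumes "\<And>k a. a \<in> set_ltl \<phi> \<Longrightarrow> h (\<sigma> k) a \<longleftrightarrow> h' (\<sigma>' k) (g a)"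
  shows "ltl_sat h \<sigma> i \<phi> \<longleftrightarrow> ltl_sat h' \<sigma>' i (map_ltl g \<phi>)"
  using assms by (induction \<phi> arbitrary: i) auto

text \<open>The conjunction tests membership only for propositions in \<open>sprops ls\<close>; both
  sets must lie in that list for agreement there to be equality.\<close>

lemma ltl_sat_choice_ltl:
  assumes "snd (\<sigma> i) \<subseteq> set (sprops ls)" and "c \<subseteq> set (sprops ls)"
  shows "ltl_sat holds_B \<sigma> i (choice_ltl ls c) \<longleftrightarrow> snd (\<sigma> i) = c"
proof -
  obtain es ss where "\<sigma> i = (es, ss)" by fastforce
  then show ?thesis
    using assms
    by (simp add: choice_ltl_def ltl_sat_LConj if_distrib[of "ltl_sat holds_B \<sigma> i"] if_bool_eq_conj
        del: if_image_distrib) auto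
qed

lemma ltl_sat_phi_legal:
  assumes "r \<in> set (valid_reactions M xs ys ls)" and "fst (\<sigma> i) = {E r}"
  shows "ltl_sat holds_B \<sigma> i (phi_legal M xs ys ls)"
proof -
  obtain ss where "\<sigma> i = ({E r}, ss)" using assms(2) by (cases "\<sigma> i") auto
  then show ?thesis
    using assms(1) by (auto simp: phi_legal_def Let_def ltl_sat_LConj ltl_sat_LDisj)
qed

text \<open>The true proposition \<open>E r\<close> triggers its implication, and the disjunct that
  then holds can only be the system output itself.\<close>

lemma ltl_sat_phi_extraD:
  assumes "ltl_sat holds_B \<sigma> i (phi_extra M xs ys ls)"
    and "r \<in> set (valid_reactions M xs ys ls)" and "fst (\<sigma> i) = {E r}"
    and "snd (\<sigma> i) \<subseteq> set (sprops ls)"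
  shows "snd (\<sigma> i) \<in> r"
proof -
  obtain ss where \<sigma>: "\<sigma> i = ({E r}, ss)" using assms(3) by (cases "\<sigma> i") auto
  have "\<exists>c\<in>set (choices ls). c \<in> r \<and> ltl_sat holds_B \<sigma> i (choice_ltl ls c)"
    using assms(1,2) \<sigma> by (auto simp: phi_extra_def ltl_sat_LConj ltl_sat_LDisj)
  then show ?thesis
    using ltl_sat_choice_ltl[of \<sigma> i ls] assms(4) by (auto simp: set_choices)
qed

text \<open>Distinctness of \<open>ls\<close> makes the index in the definite description
  unique.\<close>

lemma abs_lit_nth:
  assumes "distinct ls" and "i < length ls"
  shows "abs_lit ls (ls ! i) = S i"
proof -
  have "(THE j. j < length ls \<and> ls ! j = ls ! i) = i"
    using assms by (intro the_equality) (auto simp: nth_eq_iff_index_eq)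
  then show ?thesis by (simp add: abs_lit_def)
qed

lemma state_at_in_states:
  assumes "is_strategy Inp Out \<rho>" and "\<And>k. \<iota> k \<in> Inp"
  shows "state_at \<rho> \<iota> k \<in> states \<rho>"
  using assms by (induction k) (auto simp: is_strategy_def)

lemma output_at_in_outputs:
  assumes "is_strategy Inp Out \<rho>" and "\<And>k. \<iota> k \<in> Inp"
  shows "output_at \<rho> \<iota> k \<in> Out"
  using assms state_at_in_states[OF assms] by (auto simp: is_strategy_def output_at_def)

text \<open>Transitions depend on the input only through \<alpha> applied to its first component.
  The combined strategy therefore passes through the states of \<rho> on the partitioned inputs, and
  the values of the extra variables enter only through \<beta>.\<close>

lemma output_at_combined_adaptive_strategy:
  "output_at (combined_adaptive_strategy \<alpha> \<rho> \<beta>) \<iota> k =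
     \<beta> (fst (\<iota> k)) (snd (\<iota> k)) (output_at \<rho> (\<lambda>k. {\<alpha> (fst (\<iota> k))}) k)"
proof -
  have "state_at (combined_adaptive_strategy \<alpha> \<rho> \<beta>) \<iota> k
      = state_at \<rho> (\<lambda>k. {\<alpha> (fst (\<iota> k))}) k"
    by (induction k) (auto simp: combined_adaptive_strategy_def split: prod.splits)
  then show ?thesis
    by (auto simp: output_at_def combined_adaptive_strategy_def split: prod.splits)
qed

lemma is_strategy_combined_adaptive_strategy:
  assumes "is_strategy (Pow (eprops M xs ys ls)) (Pow (set (sprops ls))) \<rho>"
    and "partitioner M xs ys ls \<alpha>" and "adaptive_provider M xs zs ys ls \<beta>"
  shows "is_strategy (valuations (set xs) \<times> valuations (set zs)) (valuations (set ys))
           (combined_adaptive_strategy \<alpha> \<rho> \<beta>)"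
  using assms
  by (auto simp: is_strategy_def combined_adaptive_strategy_def partitioner_def
      adaptive_provider_def)

theorem theorem3:
  fixes M :: "('f, 'p, 'd) interp"
    and xs ys zs :: "'v list"
    and ls :: "('f, 'p, 'v) lit list"
    and \<phi> :: "('f, 'p, 'v) lit ltl"
    and \<alpha> :: "('v \<rightharpoonup> 'd) \<Rightarrow> eprop"
    and \<Gamma> :: "reaction \<Rightarrow> choice \<Rightarrow> ('f, 'p, 'v) fm"
    and \<beta> :: "('v \<rightharpoonup> 'd) \<Rightarrow> ('v \<rightharpoonup> 'd) \<Rightarrow> choice \<Rightarrow> ('v \<rightharpoonup> 'd)"
    and \<rho> :: "('q, eprop set, choice) strategy"
  assumes "ltl_spec xs ys ls \<phi>"
    and "realizable_T M xs ys \<phi>"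
    and "distinct zs"
    and "set zs \<inter> (set xs \<union> set ys) = {}"
    and "partitioner M xs ys ls \<alpha>"
    and "adaptive_provider_description M xs zs ys ls \<Gamma>"
    and "adaptive_provider M xs zs ys ls \<beta>"
    and "winning (Pow (eprops M xs ys ls)) (Pow (set (sprops ls)))
           (models_B (boolean_abstraction M xs ys ls \<phi>)) \<rho>"
  shows "winning (valuations (set xs) \<times> valuations (set zs)) (valuations (set ys))
           (\<lambda>\<sigma>. models_T M \<phi> (\<lambda>k. (fst (fst (\<sigma> k)), snd (\<sigma> k))))
           (combined_adaptive_strategy \<alpha> \<rho> \<beta>)"
proof -
  let ?Inp = "valuations (set xs) \<times> valuations (set zs)"
  have strat: "is_strategy (Pow (eprops M xs ys ls)) (Pow (set (sprops ls))) \<rho>"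
    using assms(8) by (simp add: winning_def)
  have "models_T M \<phi> (\<lambda>k. (fst (\<iota> k), output_at (combined_adaptive_strategy \<alpha> \<rho> \<beta>) \<iota> k))"
    if \<iota>: "\<forall>k. \<iota> k \<in> ?Inp" for \<iota>
  proof -
    \<comment> \<open>\<open>\<tau>\<close> is the Boolean play hidden in the theory play:
      \<open>e\<close> is what \<rho> reads and \<open>c\<close> the choices it answers.\<close>
    define e where "e = (\<lambda>k. {\<alpha> (fst (\<iota> k))})"
    define c where "c = output_at \<rho> e"
    define \<tau> where "\<tau> = (\<lambda>k. (e k, c k))"
    have vx: "fst (\<iota> k) \<in> valuations (set xs)" and vz: "snd (\<iota> k) \<in> valuations (set zs)" for k
      using \<iota> by (auto simp: mem_Times_iff)
    have e: "e k \<in> Pow (eprops M xs ys ls)" for k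
      using assms(5) vx by (auto simp: e_def partitioner_def)
    have c: "c k \<subseteq> set (sprops ls)" for k
      using output_at_in_outputs[OF strat e] by (auto simp: c_def)
    have model: "models_B (boolean_abstraction M xs ys ls \<phi>) \<tau>"
      using assms(8) e by (auto simp: winning_def \<tau>_def c_def)
    \<comment> \<open>The second conjunct is a box evaluated at position 0, so its implication is
      available at every position.\<close>
    then have extra: "ltl_sat holds_B \<tau> k (phi_legal M xs ys ls) \<Longrightarrow>
        ltl_sat holds_B \<tau> k (phi_extra M xs ys ls)" for k
      by (auto simp: models_B_def boolean_abstraction_def)
    have agree: "sat_lit M (fst (\<iota> k) ++ \<beta> (fst (\<iota> k)) (snd (\<iota> k)) (c k)) l
        \<longleftrightarrow> holds_B (\<tau> k) (Inr (abs_lit ls l))" if "l \<in> set_ltl \<phi>" for k l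
    proof -
      \<comment> \<open>The partitioner is pinned down only by a valid reaction that the current
        input satisfies; this \<open>r\<close> identifies the input of \<rho> at \<open>k\<close> as
        \<open>{E r}\<close>.\<close>
      obtain r where r: "r \<in> set (valid_reactions M xs ys ls)"
          and sat_r: "sat M (fst (\<iota> k)) (f_reaction ys ls r)"
        using ex_valid_reaction[OF vx] by blast
      have "fst (\<tau> k) = {E r}"
        using assms(5) vx r sat_r by (auto simp: \<tau>_def e_def partitioner_def)
      then have "c k \<in> r"
        using ltl_sat_phi_extraD[OF extra[OF ltl_sat_phi_legal[OF r]] r] c
        by (auto simp: \<tau>_def)
      then have "sat M (fst (\<iota> k) ++ \<beta> (fst (\<iota> k)) (snd (\<iota> k)) (c k)) (f_choice ls (c k))"
        using assms(7) vx vz r sat_r unfolding adaptive_provider_def by blast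
      moreover obtain i where "i < length ls" "l = ls ! i"
        using \<open>l \<in> set_ltl \<phi>\<close> assms(1) by (metis in_set_conv_nth ltl_spec_def)
      ultimately show ?thesis
        using assms(1) by (auto simp: sat_f_choice abs_lit_nth ltl_spec_def \<tau>_def)
    qed
    have "ltl_sat holds_B \<tau> 0 (map_ltl (\<lambda>l. Inr (abs_lit ls l)) \<phi>)"
      using model by (simp add: models_B_def boolean_abstraction_def)
    \<comment> \<open>Once the outputs are rewritten as \<beta> applied to the choices
      \<open>c k\<close>, the fact \<open>agree\<close> is the atomwise agreement of the two
      traces.\<close>
    then show ?thesis
      unfolding models_T_def output_at_combined_adaptive_strategy e_def[symmetric]
        c_def[symmetric]
      by (subst ltl_sat_map_ltl[where h' = holds_B and \<sigma>' = \<tau>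
            and g = "\<lambda>l. Inr (abs_lit ls l)"]) (simp_all add: agree)
  qed
  then show ?thesis
    using is_strategy_combined_adaptive_strategy[OF strat assms(5,7)] by (simp add: winning_def)
qed

end
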